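(* Let $X$ be a Banach space with a basis. Then $X$ is finite-dimensional if and only if every bounded, mean ergodic, uniformly continuous semigroup of linear operators on $X$ is uniformly mean ergodic.
   Context: A basis of a Banach space means a Schauder basis (a finite vector-space basis if the space is finite-dimensional). A strongly continuous semigroup on $X$ is a family $(T(t))_{t\ge 0}$ of bounded linear operators on $X$ with $T(0)=I$, $T(t+s)=T(t)T(s)$ for all $t,s\ge 0$, and $t\mapsto T(t)x$ continuous on $[0,\infty)$ for each $x\in X$. It is uniformly continuous if $t\mapsto T(t)$ is continuous for the operator norm (equivalently, its generator is a bounded operator), and bounded if $\sup_{t\ge 0}\|T(t)\|<\infty$. Its Cesàro means are $C(r)x:=\frac1r\int_0^r T(s)x\,ds$ for $x\in X$, $r>0$. The semigroup is called mean ergodic (respectively uniformly mean ergodic) if $C(r)$ converges strongly, i.e. $C(r)x$ converges in $X$ for every $x\in X$ (respectively converges in operator norm), as $r\to\infty$. *)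

theory Defs
  imports "HOL-Analysis.Analysis"
begin

text \<open>
  The scalar field is left as a parameter so that real and complex Banach spaces are covered
  together: by the Gelfand--Mazur theorem a \<^class>\<open>real_normed_field\<close> is isomorphic to
  \<open>\<real>\<close> or \<open>\<complex>\<close>. The type class \<^class>\<open>banach\<close> on the vectors supplies the complete norm and the
  underlying real structure, with which the scalar multiplication \<open>smul\<close> has to agree.
\<close>

locale normed_space_over = vector_space smul
  for smul :: "'k::real_normed_field \<Rightarrow> 'x::real_normed_vector \<Rightarrow> 'x" +
  assumes norm_smul: "norm (smul c x) = norm c * norm x"
    and smul_of_real: "smul (of_real r) x = r *\<^sub>R x"

definition finite_dimensional :: "('k::field \<Rightarrow> 'x::ab_group_add \<Rightarrow> 'x) \<Rightarrow> bool" where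
  "finite_dimensional smul \<longleftrightarrow> (\<exists>B. finite_dimensional_vector_space smul B)"

definition schauder_basis ::
    "('k::real_normed_field \<Rightarrow> 'x::real_normed_vector \<Rightarrow> 'x) \<Rightarrow> (nat \<Rightarrow> 'x) \<Rightarrow> bool" where
  "schauder_basis smul e \<longleftrightarrow> (\<forall>x. \<exists>!a. (\<lambda>n. smul (a n) (e n)) sums x)"

definition has_basis :: "('k::real_normed_field \<Rightarrow> 'x::real_normed_vector \<Rightarrow> 'x) \<Rightarrow> bool" where
  "has_basis smul \<longleftrightarrow>
     (\<exists>B. finite_dimensional_vector_space smul B) \<or> (\<exists>e. schauder_basis smul e)"

text \<open>
  A semigroup is a function on all of \<^typ>\<open>real\<close> of which only the values on \<open>[0, \<infinity>)\<close> matter.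
  The operators are bounded and real-linear by their type; linearity over the scalar field is a
  separate condition.
\<close>

definition strongly_continuous_semigroup ::
    "('k::real_normed_field \<Rightarrow> 'x::real_normed_vector \<Rightarrow> 'x) \<Rightarrow> (real \<Rightarrow> 'x \<Rightarrow>\<^sub>L 'x) \<Rightarrow> bool" where
  "strongly_continuous_semigroup smul T \<longleftrightarrow>
     (\<forall>t\<ge>0. Vector_Spaces.linear smul smul (blinfun_apply (T t))) \<and>
     T 0 = id_blinfun \<and>
     (\<forall>t\<ge>0. \<forall>s\<ge>0. T (t + s) = T t o\<^sub>L T s) \<and>
     (\<forall>x. continuous_on {0..} (\<lambda>t. T t x))"

definition uniformly_continuous_semigroup ::
    "('k::real_normed_field \<Rightarrow> 'x::real_normed_vector \<Rightarrow> 'x) \<Rightarrow> (real \<Rightarrow> 'x \<Rightarrow>\<^sub>L 'x) \<Rightarrow> bool" where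
  "uniformly_continuous_semigroup smul T \<longleftrightarrow>
     strongly_continuous_semigroup smul T \<and> continuous_on {0..} T"

definition bounded_semigroup :: "(real \<Rightarrow> 'x::real_normed_vector \<Rightarrow>\<^sub>L 'x) \<Rightarrow> bool" where
  "bounded_semigroup T \<longleftrightarrow> bdd_above ((\<lambda>t. norm (T t)) ` {0..})"

definition cesaro_mean :: "(real \<Rightarrow> 'x::banach \<Rightarrow>\<^sub>L 'x) \<Rightarrow> real \<Rightarrow> 'x \<Rightarrow> 'x" where
  "cesaro_mean T r x = (1 / r) *\<^sub>R integral {0..r} (\<lambda>s. T s x)"

definition mean_ergodic :: "(real \<Rightarrow> 'x::banach \<Rightarrow>\<^sub>L 'x) \<Rightarrow> bool" where
  "mean_ergodic T \<longleftrightarrow> (\<forall>x. \<exists>y. ((\<lambda>r. cesaro_mean T r x) \<longlongrightarrow> y) at_top)"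

text \<open>
  \<^const>\<open>Blinfun\<close> is meaningful only on bounded linear maps; for uniformly continuous semigroups
  this is guaranteed by \<open>bounded_linear_cesaro_mean\<close> below.
\<close>

definition uniformly_mean_ergodic :: "(real \<Rightarrow> 'x::banach \<Rightarrow>\<^sub>L 'x) \<Rightarrow> bool" where
  "uniformly_mean_ergodic T \<longleftrightarrow> (\<exists>P. ((\<lambda>r. Blinfun (cesaro_mean T r)) \<longlongrightarrow> P) at_top)"

lemma bounded_linear_cesaro_mean:
  fixes T :: "real \<Rightarrow> 'x::banach \<Rightarrow>\<^sub>L 'x"
  assumes "continuous_on {0..} T"
  shows "bounded_linear (cesaro_mean T r)"
proof -
  have "continuous_on {0..r} T"
    using assms by (rule continuous_on_subset) auto
  then have int: "T integrable_on {0..r}"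
    by (rule integrable_continuous_real)
  have "cesaro_mean T r = (\<lambda>x. (1 / r) *\<^sub>R blinfun_apply (integral {0..r} T) x)"
  proof
    fix x
    have "bounded_linear (\<lambda>A :: 'x \<Rightarrow>\<^sub>L 'x. blinfun_apply A x)"
      by (rule blinfun.bounded_linear_left)
    from integral_linear[OF int this]
    show "cesaro_mean T r x = (1 / r) *\<^sub>R blinfun_apply (integral {0..r} T) x"
      by (simp add: cesaro_mean_def o_def)
  qed
  then show ?thesis
    by (simp add: blinfun.bounded_linear_right bounded_linear_const_scaleR)
qed

end

theory Submission
  imports Defs
begin

text \<open>
  On a finite-dimensional space the coordinate functionals are continuous, so strong convergence of
  the Cesaro means, tested on the finitely many basis vectors, is convergence in operator norm.

  Conversely, given a Schauder basis \<open>e\<close>, let \<open>T t\<close> multiply the \<open>k\<close>-th coordinate by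
  \<open>exp (- t / (k + 1))\<close>. These multipliers increase with \<open>k\<close> and are bounded by 1, so summation by
  parts and the uniform boundedness of the partial sum projections make \<open>T\<close> a bounded, uniformly
  continuous semigroup. Its Cesaro means tend to 0 on every basis vector, hence strongly; but the
  eigenvalue of each mean at \<open>e k\<close> tends to 1 as \<open>k\<close> grows, so they do not tend to 0 in norm.

  Continuity of coordinates and boundedness of the projections both come from Zabreiko's lemma on
  countably subadditive seminorms, applied to the supremum of the norms of the partial sums.
\<close>

section \<open>Countably subadditive seminorms\<close>

text \<open>Baire category: in a complete space, countably many closed sets with empty interior have
  a union with empty interior, so they cannot cover everything.\<close>

lemma Baire_closed_cover:
  fixes A :: "nat \<Rightarrow> 'x::banach set"
  assumes "\<And>n. closed (A n)" and "(\<Union>n. A n) = UNIV"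
  obtains n z r where "r > 0" and "ball z r \<subseteq> A n"
proof -
  have "\<exists>n. interior (A n) \<noteq> {}"
  proof (rule ccontr)
    assume "\<not> ?thesis"
    then have "euclidean interior_of \<Union> (range A) = {}"
      using assms(1) by (intro Baire_category_alt) (auto simp: completely_metrizable_space_euclidean)
    then show False using assms(2) by simp
  qed
  then show ?thesis
    using that by (auto simp: mem_interior)
qed

text \<open>Zabreiko's lemma.\<close>

lemma countably_subadditive_seminorm_bounded:
  fixes p :: "'x::banach \<Rightarrow> real"
  assumes scale: "\<And>c x. p (c *\<^sub>R x) = \<bar>c\<bar> * p x"
    and triangle: "\<And>x y. p (x + y) \<le> p x + p y"
    and series: "\<And>u x. u sums x \<Longrightarrow> summable (\<lambda>n. p (u n)) \<Longrightarrow> p x \<le> (\<Sum>n. p (u n))"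
  shows "\<exists>K\<ge>0. \<forall>x. p x \<le> K * norm x"
proof -
  define A where "A n = {x. p x \<le> real n}" for n
  have p_minus: "p (- x) = p x" for x
    using scale[of "-1" x] by simp
  have p_0: "p 0 = 0"
    using scale[of 0 0] by simp
  have cover: "(\<Union>n. closure (A n)) = UNIV"
  proof safe
    fix x
    obtain n where "p x \<le> real n" using real_arch_simple by blast
    then show "x \<in> (\<Union>n. closure (A n))"
      using closure_subset by (fastforce simp: A_def)
  qed simp
  obtain n z r where r: "r > 0" and ball: "ball z r \<subseteq> closure (A n)"
    by (rule Baire_closed_cover[OF closed_closure cover])
  \<comment> \<open>The ball has an unknown centre z. Half the difference of approximants of z + x
    and z - x approximates x itself, and since p is even and subadditive its p-value is still at
    most n. This moves the ball to the origin.\<close>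
  have near: "\<exists>y. p y \<le> real n \<and> norm (x - y) < d" if "norm x < r" "d > 0" for x d
  proof -
    have "z + x \<in> closure (A n)" "z - x \<in> closure (A n)"
      using ball that by (auto simp: dist_norm subset_iff)
    then obtain u v where u: "u \<in> A n" "dist u (z + x) < d" and v: "v \<in> A n" "dist v (z - x) < d"
      using \<open>d > 0\<close> unfolding closure_approachable by blast
    define y where "y = (1/2) *\<^sub>R (u - v)"
    have "p y = (1/2) * p (u + - v)"
      unfolding y_def by (simp add: scale)
    also have "\<dots> \<le> real n"
      using triangle[of u "- v"] p_minus u(1) v(1) by (simp add: A_def)
    finally have "p y \<le> real n" .
    moreover have "(z + x - u) - (z - x - v) = (x + x) - (u - v)"
      by simp
    then have "x - y = (1/2) *\<^sub>R ((z + x - u) - (z - x - v))"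
      by (simp only: y_def scaleR_diff_right scaleR_half_double)
    then have "norm (x - y) \<le> (1/2) * (norm (z + x - u) + norm (z - x - v))"
      using norm_triangle_ineq4[of "z + x - u" "z - x - v"] by simp
    then have "norm (x - y) < d"
      using u(2) v(2) by (simp add: dist_norm norm_minus_commute)
    ultimately show ?thesis by blast
  qed
  \<comment> \<open>By homogeneity: dividing x by c = 2 * norm x / r gives norm r/2, and
    approximating the quotient within norm x / (2 * c) leaves an error of norm x / 2 after scaling
    back. The cost is c * n = L * norm x.\<close>
  define L where "L = 2 * real n / r"
  have "\<exists>y. p y \<le> L * norm x \<and> norm (x - y) \<le> norm x / 2" for x
  proof (cases "x = 0")
    case True
    then show ?thesis by (auto intro!: exI[of _ 0] simp: p_0)
  next
    case False
    define c where "c = 2 * norm x / r"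
    have c: "c > 0" using False r by (simp add: c_def)
    have "norm ((1/c) *\<^sub>R x) < r"
      using False r by (simp add: c_def)
    moreover have "norm x / (2 * c) > 0"
      using c False by simp
    ultimately obtain y where y: "p y \<le> real n" "norm ((1/c) *\<^sub>R x - y) < norm x / (2 * c)"
      using near by blast
    have "x - c *\<^sub>R y = c *\<^sub>R ((1/c) *\<^sub>R x - y)"
      using c by (simp add: algebra_simps)
    then have "norm (x - c *\<^sub>R y) = c * norm ((1/c) *\<^sub>R x - y)"
      using c by (metis abs_of_pos norm_scaleR)
    also have "\<dots> \<le> norm x / 2"
      using y(2) c by (simp add: field_simps)
    finally have "norm (x - c *\<^sub>R y) \<le> norm x / 2" .
    moreover have "p (c *\<^sub>R y) \<le> c * real n"
      using y(1) c by (simp add: scale mult_left_mono)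
    then have "p (c *\<^sub>R y) \<le> L * norm x"
      by (simp add: c_def L_def mult_ac)
    ultimately show ?thesis by blast
  qed
  then obtain Y where pY: "\<And>x. p (Y x) \<le> L * norm x" and Y: "\<And>x. norm (x - Y x) \<le> norm x / 2"
    by metis
  have L: "L \<ge> 0" using r by (simp add: L_def)
  have "p x \<le> 2 * L * norm x" for x
  proof -
    \<comment> \<open>Iterate the approximation on the residual. Residuals halve at each step, so x
      is the series of the \<open>Y (R k)\<close>, whose p-values are dominated by a geometric
      series; its sum supplies the factor 2.\<close>
    define R where "R k = ((\<lambda>v. v - Y v) ^^ k) x" for k
    have R_Suc: "R (Suc k) = R k - Y (R k)" for k
      by (simp add: R_def)
    have norm_R: "norm (R k) \<le> norm x * (1/2) ^ k" for k
    proof (induction k)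
      case 0
      show ?case by (simp add: R_def)
    next
      case (Suc k)
      then show ?case using Y[of "R k"] by (simp add: R_Suc)
    qed
    have "(\<lambda>k. norm x * (1/2) ^ k) \<longlonglongrightarrow> 0"
      by (intro tendsto_mult_right_zero LIMSEQ_power_zero) simp
    then have "R \<longlonglongrightarrow> 0"
      by (rule Lim_null_comparison[rotated]) (use norm_R in auto)
    then have "(\<lambda>k. R k - R (Suc k)) sums (R 0 - 0)"
      by (rule telescope_sums')
    then have sums: "(\<lambda>k. Y (R k)) sums x"
      by (simp add: R_Suc) (simp add: R_def)
    have geo: "(\<lambda>k. L * norm x * (1/2) ^ k) sums (L * norm x * 2)"
      using geometric_sums[of "1/2 :: real"] by (intro sums_mult) simp
    have le: "p (Y (R k)) \<le> L * norm x * (1/2) ^ k" for k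
      using order_trans[OF pY[of "R k"] mult_left_mono[OF norm_R L]] by (simp add: mult_ac)
    have p_nonneg: "p v \<ge> 0" for v
      using triangle[of v "- v"] p_minus[of v] p_0 by simp
    have summ: "summable (\<lambda>k. p (Y (R k)))"
      by (rule summable_comparison_test'[OF sums_summable[OF geo]]) (use le p_nonneg in auto)
    have "p x \<le> (\<Sum>k. p (Y (R k)))"
      using sums summ by (rule series)
    also have "\<dots> \<le> L * norm x * 2"
      using suminf_le[OF le summ sums_summable[OF geo]] sums_unique[OF geo] by simp
    finally show ?thesis by simp
  qed
  with L show ?thesis
    by (intro exI[of _ "2 * L"]) simp
qed

section \<open>Unique expansions\<close>

context normed_space_over
begin

lemma smul_scaleR: "smul c (r *\<^sub>R x) = r *\<^sub>R smul c x"
  by (simp add: mult.commute flip: smul_of_real)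

lemma smul_scaleR_left: "smul (r *\<^sub>R c) x = r *\<^sub>R smul c x"
  by (simp add: scaleR_conv_of_real flip: smul_of_real)

lemma bounded_linear_smul_right: "bounded_linear (smul c)"
  by (rule bounded_linear_intro[where K = "norm c"])
    (simp_all add: scale_right_distrib smul_scaleR norm_smul)

lemma bounded_linear_smul_left: "bounded_linear (\<lambda>c. smul c x)"
  by (rule bounded_linear_intro[where K = "norm x"])
    (simp_all add: scale_left_distrib norm_smul smul_scaleR_left)

end

text \<open>
  Requiring \<open>a n = 0\<close> wherever \<open>e n = 0\<close> makes this notion cover both Schauder bases and finite
  bases padded by zeros.
\<close>

locale expansion_system = normed_space_over smul
  for smul :: "'k::{real_normed_field,banach} \<Rightarrow> 'x::banach \<Rightarrow> 'x" +
  fixes e :: "nat \<Rightarrow> 'x"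
  assumes unique_expansion:
    "\<exists>!a. (\<forall>n. e n = 0 \<longrightarrow> a n = 0) \<and> (\<lambda>n. smul (a n) (e n)) sums x"
begin

section \<open>Coordinates and partial sums\<close>

definition coord :: "'x \<Rightarrow> nat \<Rightarrow> 'k" where
  "coord x = (THE a. (\<forall>n. e n = 0 \<longrightarrow> a n = 0) \<and> (\<lambda>n. smul (a n) (e n)) sums x)"

definition partial_sum :: "nat \<Rightarrow> 'x \<Rightarrow> 'x" where
  "partial_sum n x = (\<Sum>k<n. smul (coord x k) (e k))"

text \<open>The usual renorming attached to a basis. The real supremum is meaningful because
  convergent partial sums are bounded.\<close>

definition maximal_norm :: "'x \<Rightarrow> real" where
  "maximal_norm x = (SUP n. norm (partial_sum n x))"

lemma coord_eq_0: "e n = 0 \<Longrightarrow> coord x n = 0"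
  and sums_coord: "(\<lambda>n. smul (coord x n) (e n)) sums x"
  using theI'[OF unique_expansion[of x]] unfolding coord_def by auto

lemma coord_eqI:
  assumes "\<And>n. e n = 0 \<Longrightarrow> a n = 0" and "(\<lambda>n. smul (a n) (e n)) sums x"
  shows "coord x = a"
  unfolding coord_def by (rule the1_equality[OF unique_expansion]) (use assms in auto)

lemma coord_add: "coord (x + y) n = coord x n + coord y n"
proof -
  have "coord (x + y) = (\<lambda>n. coord x n + coord y n)"
    using sums_add[OF sums_coord[of x] sums_coord[of y]]
    by (intro coord_eqI) (simp_all add: coord_eq_0 scale_left_distrib)
  then show ?thesis by simp
qed

lemma coord_smul: "coord (smul c x) n = c * coord x n"
proof -
  have "coord (smul c x) = (\<lambda>n. c * coord x n)"
    using bounded_linear.sums[OF bounded_linear_smul_right sums_coord[of x], of c]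
    by (intro coord_eqI) (simp_all add: coord_eq_0)
  then show ?thesis by simp
qed

lemma coord_scaleR: "coord (r *\<^sub>R x) n = r *\<^sub>R coord x n"
  using coord_smul[of "of_real r" x n] by (simp add: smul_of_real scaleR_conv_of_real)

text \<open>At a padding index, where \<open>e k = 0\<close>, the admissible expansion is the zero
  sequence; hence the case distinction.\<close>

lemma coord_basis: "coord (e k) n = (if n = k \<and> e k \<noteq> 0 then 1 else 0)"
proof -
  let ?d = "\<lambda>n. if n = k \<and> e k \<noteq> 0 then 1 else 0"
  have "(\<lambda>n. smul (?d n) (e n)) = (\<lambda>n. if n = k then e n else 0)"
    by auto
  then have "(\<lambda>n. smul (?d n) (e n)) sums e k"
    by (simp add: sums_single)
  then have "coord (e k) = (\<lambda>n. if n = k \<and> e k \<noteq> 0 then 1 else 0)"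
    by (intro coord_eqI) (auto split: if_splits)
  then show ?thesis by simp
qed

lemma partial_sum_add: "partial_sum n (x + y) = partial_sum n x + partial_sum n y"
  by (simp add: partial_sum_def coord_add scale_left_distrib sum.distrib)

lemma partial_sum_smul: "partial_sum n (smul c x) = smul c (partial_sum n x)"
  by (simp add: partial_sum_def coord_smul scale_sum_right)

lemma partial_sum_scaleR: "partial_sum n (r *\<^sub>R x) = r *\<^sub>R partial_sum n x"
  using partial_sum_smul[of n "of_real r" x] by (simp add: smul_of_real)

lemma partial_sum_tendsto: "(\<lambda>n. partial_sum n x) \<longlonglongrightarrow> x"
  using sums_coord[of x] by (simp add: sums_def partial_sum_def)

section \<open>Estimates for the maximal norm\<close>

lemma norm_partial_sum_le_maximal: "norm (partial_sum n x) \<le> maximal_norm x"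
proof -
  have "bounded (range (\<lambda>n. partial_sum n x))"
    using partial_sum_tendsto by (rule convergent_imp_bounded)
  then have "bdd_above (range (\<lambda>n. norm (partial_sum n x)))"
    by (auto simp: bounded_iff bdd_above_def)
  then show ?thesis
    unfolding maximal_norm_def by (rule cSUP_upper[OF UNIV_I])
qed

lemma norm_le_maximal: "norm x \<le> maximal_norm x"
  using norm_partial_sum_le_maximal
  by (intro LIMSEQ_le_const2[OF tendsto_norm[OF partial_sum_tendsto]]) auto

lemma maximal_norm_le: "(\<And>n. norm (partial_sum n x) \<le> b) \<Longrightarrow> maximal_norm x \<le> b"
  unfolding maximal_norm_def by (rule cSUP_least) auto

text \<open>A term is the difference of two consecutive partial sums, hence the factor 2.
  Coordinates are thereby controlled before they are known to be continuous in the original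
  norm.\<close>

lemma norm_term_le_maximal: "norm (smul (coord x n) (e n)) \<le> 2 * maximal_norm x"
proof -
  have "smul (coord x n) (e n) = partial_sum (Suc n) x - partial_sum n x"
    by (simp add: partial_sum_def)
  then show ?thesis
    using norm_triangle_ineq4[of "partial_sum (Suc n) x" "partial_sum n x"]
      norm_partial_sum_le_maximal[of "Suc n" x] norm_partial_sum_le_maximal[of n x] by simp
qed

lemma maximal_norm_scaleR: "maximal_norm (r *\<^sub>R x) = \<bar>r\<bar> * maximal_norm x"
proof -
  have le: "maximal_norm (r *\<^sub>R x) \<le> \<bar>r\<bar> * maximal_norm x" for r x
    by (rule maximal_norm_le)
      (simp add: partial_sum_scaleR mult_left_mono norm_partial_sum_le_maximal)
  show ?thesis
  proof (cases "r = 0")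
    case True
    then show ?thesis using le[of 0 x] norm_le_maximal[of 0] by simp
  next
    case False
    have "maximal_norm x = maximal_norm ((1 / r) *\<^sub>R (r *\<^sub>R x))"
      using False by simp
    also have "\<dots> \<le> \<bar>1 / r\<bar> * maximal_norm (r *\<^sub>R x)"
      by (rule le)
    finally have "\<bar>r\<bar> * maximal_norm x \<le> maximal_norm (r *\<^sub>R x)"
      using False by (simp add: field_simps)
    with le[of r x] show ?thesis by simp
  qed
qed

lemma maximal_norm_triangle: "maximal_norm (x + y) \<le> maximal_norm x + maximal_norm y"
proof (rule maximal_norm_le)
  fix n
  show "norm (partial_sum n (x + y)) \<le> maximal_norm x + maximal_norm y"
    using norm_triangle_ineq[of "partial_sum n x" "partial_sum n y"]
      norm_partial_sum_le_maximal[of n x] norm_partial_sum_le_maximal[of n y]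
    by (simp add: partial_sum_add)
qed

text \<open>Continuity of the coordinates is not yet available, so the expansion of x is built by
  hand: the coordinates of the \<open>u j\<close> are summed index by index, the resulting series is
  shown to converge to x, and uniqueness identifies its coefficients.\<close>

lemma maximal_norm_series:
  assumes u: "u sums x" and summable_max: "summable (\<lambda>j. maximal_norm (u j))"
  shows "maximal_norm x \<le> (\<Sum>j. maximal_norm (u j))"
proof -
  \<comment> \<open>Absolute summability gives summability because the scalar field is
    complete.\<close>
  have summable_coord: "summable (\<lambda>j. coord (u j) k)" for k
  proof (cases "e k = 0")
    case True
    then show ?thesis by (simp add: coord_eq_0)
  next
    case False
    have "norm (coord (u j) k) \<le> 2 / norm (e k) * maximal_norm (u j)" for j
      using norm_term_le_maximal[of "u j" k] False by (simp add: norm_smul field_simps)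
    then show ?thesis
      by (rule summable_comparison_test'[OF summable_mult[OF summable_max]])
  qed
  define a where "a k = (\<Sum>j. coord (u j) k)" for k
  have "(\<lambda>j. smul (coord (u j) k) (e k)) sums smul (a k) (e k)" for k
    using bounded_linear.sums[OF bounded_linear_smul_left summable_sums[OF summable_coord]]
    by (simp add: a_def)
  then have sums_partial: "(\<lambda>j. partial_sum n (u j)) sums (\<Sum>k<n. smul (a k) (e k))" for n
    unfolding partial_sum_def by (intro sums_sum) auto
  have tail_le: "norm (u j - partial_sum n (u j)) \<le> 2 * maximal_norm (u j)" for j n
    using norm_triangle_ineq4[of "u j" "partial_sum n (u j)"]
      norm_le_maximal[of "u j"] norm_partial_sum_le_maximal[of n "u j"] by simp
  have summable_tail: "summable (\<lambda>j. norm (u j - partial_sum n (u j)))" for n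
    by (rule summable_comparison_test'[OF summable_mult[OF summable_max, of 2]])
      (use tail_le in simp)
  have tail_tendsto: "(\<lambda>n. norm (u j - partial_sum n (u j))) \<longlonglongrightarrow> 0" for j
    using tendsto_norm[OF tendsto_diff[OF tendsto_const partial_sum_tendsto[of "u j"]], of "u j"]
    by simp
  \<comment> \<open>Interchange of the limit in n with the sum over j: for each j the remainder
    tends to 0, and it is dominated by \<open>2 * maximal_norm (u j)\<close> uniformly in n.\<close>
  have tannery: "(\<lambda>n. \<Sum>j. norm (u j - partial_sum n (u j))) \<longlonglongrightarrow> 0"
    using tannerys_theorem[where a = "\<lambda>j n. norm (u j - partial_sum n (u j))" and F = sequentially,
        OF tail_tendsto _ summable_mult[OF summable_max, of 2]] tail_le
    by (simp add: case_prod_unfold)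
  have "norm ((\<Sum>k<n. smul (a k) (e k)) - x) \<le> (\<Sum>j. norm (u j - partial_sum n (u j)))" for n
  proof -
    have "(\<lambda>j. u j - partial_sum n (u j)) sums (x - (\<Sum>k<n. smul (a k) (e k)))"
      using u sums_partial by (rule sums_diff)
    then show ?thesis
      using summable_norm[OF summable_tail[of n]] by (simp add: sums_iff norm_minus_commute)
  qed
  then have "(\<lambda>n. (\<Sum>k<n. smul (a k) (e k)) - x) \<longlonglongrightarrow> 0"
    using tannery by (intro Lim_null_comparison[OF _ tannery]) auto
  then have "(\<lambda>k. smul (a k) (e k)) sums x"
    by (simp add: sums_def LIM_zero_iff)
  then have coord_x: "coord x = a"
    by (intro coord_eqI) (simp_all add: a_def coord_eq_0)
  show ?thesis
  proof (rule maximal_norm_le)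
    fix n
    have "summable (\<lambda>j. norm (partial_sum n (u j)))"
      by (rule summable_comparison_test'[OF summable_max]) (simp add: norm_partial_sum_le_maximal)
    then have "norm (\<Sum>j. partial_sum n (u j)) \<le> (\<Sum>j. maximal_norm (u j))"
      using summable_max norm_partial_sum_le_maximal
      by (intro order_trans[OF summable_norm suminf_le])
    then show "norm (partial_sum n x) \<le> (\<Sum>j. maximal_norm (u j))"
      using sums_partial[of n] by (simp add: sums_iff coord_x partial_sum_def)
  qed
qed

text \<open>Finiteness of the basis constant: Zabreiko's lemma bounds the maximal norm by a multiple
  of the original one.\<close>

lemma partial_sums_uniformly_bounded:
  obtains K where "K \<ge> 0" and "\<And>n x. norm (partial_sum n x) \<le> K * norm x"
proof -
  have "\<exists>K\<ge>0. \<forall>x. maximal_norm x \<le> K * norm x"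
    by (intro countably_subadditive_seminorm_bounded maximal_norm_scaleR maximal_norm_triangle
        maximal_norm_series)
  then show ?thesis
    using that order_trans[OF norm_partial_sum_le_maximal] by blast
qed

lemma coord_bounded:
  obtains L where "L \<ge> 0" and "\<And>x. norm (coord x k) \<le> L * norm x"
proof -
  obtain K where K: "K \<ge> 0" "\<And>n x. norm (partial_sum n x) \<le> K * norm x"
    using partial_sums_uniformly_bounded by blast
  show ?thesis
  proof (cases "e k = 0")
    case True
    then show ?thesis using that[of 0] by (simp add: coord_eq_0)
  next
    case False
    have "norm (coord x k) \<le> 2 * K / norm (e k) * norm x" for x
    proof -
      have "maximal_norm x \<le> K * norm x" using K(2) by (rule maximal_norm_le)
      then show ?thesis
        using norm_term_le_maximal[of x k] False by (simp add: norm_smul field_simps)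
    qed
    then show ?thesis
      using that[of "2 * K / norm (e k)"] K(1) by simp
  qed
qed

end

section \<open>Finite-dimensional spaces\<close>

text \<open>The type of operators gives real linearity only. Scalar linearity, needed to expand the
  means in coordinates, passes through the integral because \<open>smul c\<close> is bounded and
  real-linear.\<close>

lemma cesaro_mean_smul:
  assumes "normed_space_over smul" and "strongly_continuous_semigroup smul T"
  shows "cesaro_mean T r (smul c x) = smul c (cesaro_mean T r x)"
proof -
  interpret normed_space_over smul by fact
  have "continuous_on {0..r} (\<lambda>s. T s x)"
    using assms unfolding strongly_continuous_semigroup_def
    by (auto intro: continuous_on_subset)
  then have "(\<lambda>s. T s x) integrable_on {0..r}"
    by (rule integrable_continuous_real)
  from integral_linear[OF this bounded_linear_smul_right]
  have "smul c (integral {0..r} (\<lambda>s. T s x)) = integral {0..r} (\<lambda>s. smul c (T s x))"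
    by (simp add: o_def)
  also have "\<dots> = integral {0..r} (\<lambda>s. T s (smul c x))"
    using assms unfolding strongly_continuous_semigroup_def Vector_Spaces.linear_iff
    by (intro integral_cong) auto
  finally show ?thesis
    by (simp add: cesaro_mean_def smul_scaleR)
qed

text \<open>An operator-norm limit is also the strong limit, which later identifies it. Continuity
  of T ensures that \<open>Blinfun\<close> returns the actual mean.\<close>

lemma uniformly_mean_ergodic_tendsto:
  assumes "continuous_on {0..} T" and "((\<lambda>r. Blinfun (cesaro_mean T r)) \<longlongrightarrow> P) F"
  shows "((\<lambda>r. cesaro_mean T r x) \<longlongrightarrow> P x) F"
  using blinfun.tendsto[OF assms(2) tendsto_const[of x]]
  by (simp add: bounded_linear_Blinfun_apply bounded_linear_cesaro_mean assms(1))

context expansion_system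
begin

lemma norm_smul_coord_le:
  obtains L where "L \<ge> 0" and "\<And>x y. norm (smul (coord x k) y) \<le> L * norm y * norm x"
proof -
  obtain L where L: "L \<ge> 0" "\<And>x. norm (coord x k) \<le> L * norm x"
    using coord_bounded by blast
  have "norm (smul (coord x k) y) \<le> L * norm y * norm x" for x y
    using mult_right_mono[OF L(2)[of x] norm_ge_zero[of y]] by (simp add: norm_smul mult_ac)
  with L(1) show ?thesis by (rule that)
qed

lemma bounded_linear_smul_coord: "bounded_linear (\<lambda>x. smul (coord x k) y)"
proof -
  obtain L where "\<And>x y. norm (smul (coord x k) y) \<le> L * norm y * norm x"
    using norm_smul_coord_le by blast
  then show ?thesis
    by (intro bounded_linear_intro[where K = "L * norm y"])
      (simp_all add: coord_add coord_scaleR scale_left_distrib smul_scaleR_left mult.commute)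
qed

text \<open>The rank-one operator depends linearly and boundedly on the vector y, so convergence of
  vectors becomes convergence in operator norm.\<close>

lemma tendsto_Blinfun_smul_coord:
  assumes "(f \<longlongrightarrow> y) F"
  shows "((\<lambda>r. Blinfun (\<lambda>x. smul (coord x k) (f r))) \<longlongrightarrow> Blinfun (\<lambda>x. smul (coord x k) y)) F"
proof -
  obtain L where L: "L \<ge> 0" "\<And>x y. norm (smul (coord x k) y) \<le> L * norm y * norm x"
    using norm_smul_coord_le by blast
  have "bounded_linear (\<lambda>y. Blinfun (\<lambda>x. smul (coord x k) y))"
  proof (rule bounded_linear_intro[where K = L])
    show "norm (Blinfun (\<lambda>x. smul (coord x k) y)) \<le> norm y * L" for y
      using L by (intro norm_blinfun_bound)
        (simp_all add: bounded_linear_Blinfun_apply bounded_linear_smul_coord mult.commute)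
    have Blinfun_app: "Blinfun (\<lambda>x. smul (coord x k) y) x = smul (coord x k) y" for x y
      by (simp add: bounded_linear_Blinfun_apply bounded_linear_smul_coord)
    show "Blinfun (\<lambda>x. smul (coord x k) (y + z)) =
        Blinfun (\<lambda>x. smul (coord x k) y) + Blinfun (\<lambda>x. smul (coord x k) z)" for y z
      by (rule blinfun_eqI) (unfold blinfun.add_left Blinfun_app, rule scale_right_distrib)
    show "Blinfun (\<lambda>x. smul (coord x k) (r *\<^sub>R y)) = r *\<^sub>R Blinfun (\<lambda>x. smul (coord x k) y)" for r y
      by (rule blinfun_eqI) (unfold blinfun.scaleR_left Blinfun_app, rule smul_scaleR)
  qed
  then show ?thesis using assms by (rule bounded_linear.tendsto)
qed

text \<open>With only N basis vectors, each mean is a sum of N rank-one operators built from its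
  values on the basis; each summand converges in norm.\<close>

lemma mean_ergodic_imp_uniformly:
  assumes e_0: "\<And>n. n \<ge> N \<Longrightarrow> e n = 0"
    and T: "uniformly_continuous_semigroup smul T" and "mean_ergodic T"
  shows "uniformly_mean_ergodic T"
proof -
  have strong: "strongly_continuous_semigroup smul T" and cont: "continuous_on {0..} T"
    using T by (auto simp: uniformly_continuous_semigroup_def)
  obtain y where y: "\<And>k. ((\<lambda>r. cesaro_mean T r (e k)) \<longlongrightarrow> y k) at_top"
    using choice[of "\<lambda>k y. ((\<lambda>r. cesaro_mean T r (e k)) \<longlongrightarrow> y) at_top"] \<open>mean_ergodic T\<close>
    unfolding mean_ergodic_def by blast
  have "Blinfun (cesaro_mean T r) = (\<Sum>k<N. Blinfun (\<lambda>x. smul (coord x k) (cesaro_mean T r (e k))))"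
    for r
  proof (rule blinfun_eqI)
    fix x
    have lin: "bounded_linear (cesaro_mean T r)"
      using cont by (rule bounded_linear_cesaro_mean)
    have "(\<lambda>k. smul (coord x k) (e k)) sums (\<Sum>k<N. smul (coord x k) (e k))"
      by (rule sums_finite) (auto simp: e_0)
    then have x_eq: "(\<Sum>k<N. smul (coord x k) (e k)) = x"
      using sums_coord by (rule sums_unique2)
    have "cesaro_mean T r x = (\<Sum>k<N. cesaro_mean T r (smul (coord x k) (e k)))"
      using linear_sum[OF bounded_linear.linear[OF lin], of "\<lambda>k. smul (coord x k) (e k)" "{..<N}"]
      unfolding x_eq .
    then show "Blinfun (cesaro_mean T r) x =
        (\<Sum>k<N. Blinfun (\<lambda>x. smul (coord x k) (cesaro_mean T r (e k)))) x"
      by (simp add: bounded_linear_Blinfun_apply lin bounded_linear_smul_coord blinfun.sum_left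
          cesaro_mean_smul[OF normed_space_over_axioms strong])
  qed
  moreover have "((\<lambda>r. \<Sum>k<N. Blinfun (\<lambda>x. smul (coord x k) (cesaro_mean T r (e k)))) \<longlongrightarrow>
      (\<Sum>k<N. Blinfun (\<lambda>x. smul (coord x k) (y k)))) at_top"
    by (intro tendsto_sum tendsto_Blinfun_smul_coord y)
  ultimately show ?thesis
    unfolding uniformly_mean_ergodic_def by auto
qed

end

text \<open>Enumerate the basis B and continue the sequence by zeros; every series then reduces to a
  finite sum.\<close>

lemma finite_basis_expansion_system:
  fixes smul :: "'k::{real_normed_field,banach} \<Rightarrow> 'x::banach \<Rightarrow> 'x"
  assumes "normed_space_over smul" and "finite_dimensional_vector_space smul B"
  obtains e N where "expansion_system smul e" and "\<And>n. n \<ge> N \<Longrightarrow> e n = 0"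
proof -
  interpret normed_space_over smul by fact
  interpret finite_dimensional_vector_space smul B by fact
  obtain f where f: "bij_betw f {0..<card B} B"
    using ex_bij_betw_nat_finite[OF finite_Basis] by blast
  define e where "e n = (if n < card B then f n else 0)" for n
  have e_bij: "bij_betw e {..<card B} B"
    using f by (subst bij_betw_cong[of _ _ f]) (auto simp: e_def atLeast0LessThan)
  have e_nz: "e n \<noteq> 0" if "n < card B" for n
    using that e_bij dependent_zero independent_Basis by (metis bij_betwE lessThan_iff)
  have sums_finite_e: "(\<lambda>n. smul (a n) (e n)) sums (\<Sum>n<card B. smul (a n) (e n))" for a
    by (rule sums_finite) (auto simp: e_def)
  have "expansion_system smul e"
  proof (unfold_locales, rule ex_ex1I)
    fix x
    define a where "a n = (if n < card B then representation B x (e n) else 0)" for n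
    have "(\<Sum>n<card B. smul (a n) (e n)) = (\<Sum>n<card B. smul (representation B x (e n)) (e n))"
      by (rule sum.cong) (auto simp: a_def)
    also have "\<dots> = (\<Sum>b\<in>B. smul (representation B x b) b)"
      using e_bij by (rule sum.reindex_bij_betw)
    also have "\<dots> = x"
      by (rule sum_representation_eq) (simp_all add: independent_Basis span_Basis finite_Basis)
    finally show "\<exists>a. (\<forall>n. e n = 0 \<longrightarrow> a n = 0) \<and> (\<lambda>n. smul (a n) (e n)) sums x"
      using sums_finite_e[of a] e_nz by (intro exI[of _ a]) (auto simp: a_def)
  next
    fix x a b
    assume a: "(\<forall>n. e n = 0 \<longrightarrow> a n = 0) \<and> (\<lambda>n. smul (a n) (e n)) sums x"
      and b: "(\<forall>n. e n = 0 \<longrightarrow> b n = 0) \<and> (\<lambda>n. smul (b n) (e n)) sums x"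
    \<comment> \<open>Linear independence speaks of coefficients indexed by vectors of B, so the
      difference of the two coefficient sequences is transported along the inverse
      enumeration.\<close>
    define u where "u v = a (the_inv_into {..<card B} e v) - b (the_inv_into {..<card B} e v)" for v
    have inj: "inj_on e {..<card B}" using e_bij by (rule bij_betw_imp_inj_on)
    have u_e: "u (e n) = a n - b n" if "n < card B" for n
      using that by (simp add: u_def the_inv_into_f_f[OF inj])
    have "(\<Sum>v\<in>B. smul (u v) v) = (\<Sum>n<card B. smul (u (e n)) (e n))"
      using sum.reindex_bij_betw[OF e_bij, of "\<lambda>v. smul (u v) v"] by simp
    also have "\<dots> = (\<Sum>n<card B. smul (a n) (e n)) - (\<Sum>n<card B. smul (b n) (e n))"
      by (simp add: u_e scale_left_diff_distrib sum_subtractf)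
    also have "\<dots> = 0"
      using sums_unique2[OF sums_finite_e conjunct2[OF a]]
        sums_unique2[OF sums_finite_e conjunct2[OF b]] by simp
    finally have "u v = 0" if "v \<in> B" for v
      using independentD[OF independent_Basis finite_Basis subset_refl _ that] by simp
    then have u_0: "u (e n) = 0" if "n < card B" for n
      using that bij_betwE[OF e_bij] by simp
    show "a = b"
    proof
      fix n
      show "a n = b n"
      proof (cases "n < card B")
        case True
        then show ?thesis using u_0[OF True] u_e[OF True] by simp
      next
        \<comment> \<open>On the padding both sequences vanish by the side condition.\<close>
        case False
        then show ?thesis using a b by (simp add: e_def)
      qed
    qed
  qed
  then show ?thesis
    using that[of e "card B"] by (simp add: e_def)
qed

section \<open>The diagonal semigroup of a Schauder basis\<close>

text \<open>Factor out exp (- a), which is at most 1, and use 1 - exp (- h) \<le> h. This yields the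
  majorant in the proof of norm continuity.\<close>

lemma exp_minus_diff_le:
  fixes a b :: real
  assumes "0 \<le> a" and "a \<le> b"
  shows "exp (- a) - exp (- b) \<le> b - a"
proof -
  have le: "1 - exp (- (b - a)) \<le> b - a"
    using exp_ge_add_one_self[of "- (b - a)"] by linarith
  have "exp (- a) - exp (- b) = exp (- a) * (1 - exp (- (b - a)))"
    by (simp add: right_diff_distrib flip: exp_add)
  also have "\<dots> \<le> 1 * (b - a)"
    by (rule mult_mono[OF _ le]) (use assms in auto)
  finally show ?thesis by simp
qed

lemma exp_minus_scaleR_has_integral:
  fixes v :: "'x::banach"
  assumes "r \<ge> 0" and "c > 0"
  shows "((\<lambda>s. exp (- s / c) *\<^sub>R v) has_integral (c * (1 - exp (- r / c))) *\<^sub>R v) {0..r}"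
proof -
  have "((\<lambda>s. exp (- s / c)) has_integral (- c * exp (- r / c)) - (- c * exp (- 0 / c))) {0..r}"
    using assms
    by (intro fundamental_theorem_of_calculus)
      (auto intro!: derivative_eq_intros simp flip: has_real_derivative_iff_has_vector_derivative)
  then show ?thesis
    by (intro has_integral_scaleR_left) (simp add: algebra_simps)
qed

context expansion_system
begin

section \<open>Operators tested on the basis\<close>

lemma bounded_linear_partial_sum: "bounded_linear (partial_sum n)"
proof -
  obtain K where "\<And>n x. norm (partial_sum n x) \<le> K * norm x"
    using partial_sums_uniformly_bounded by blast
  then show ?thesis
    by (intro bounded_linear_intro[where K = K])
      (simp_all add: partial_sum_add partial_sum_scaleR mult.commute)
qed

lemma partial_sum_basis: "partial_sum n (e k) = (if k < n then e k else 0)"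
proof -
  have "partial_sum n (e k) = (\<Sum>j<n. if j = k then e k else 0)"
    unfolding partial_sum_def by (rule sum.cong) (auto simp: coord_basis)
  then show ?thesis by simp
qed

lemma sums_blinfun_coord:
  fixes A :: "'x \<Rightarrow>\<^sub>L 'x"
  assumes "\<And>c x. A (smul c x) = smul c (A x)"
  shows "(\<lambda>n. smul (coord x n) (A (e n))) sums A x"
  using bounded_linear.sums[OF blinfun.bounded_linear_right sums_coord, of A x]
  by (simp add: assms)

text \<open>Both images of x are sums of the same series. This reduces the semigroup law to the
  eigenvectors \<open>e n\<close>.\<close>

lemma blinfun_eq_on_basis:
  fixes A B :: "'x \<Rightarrow>\<^sub>L 'x"
  assumes "\<And>c x. A (smul c x) = smul c (A x)" and "\<And>c x. B (smul c x) = smul c (B x)"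
    and "\<And>n. A (e n) = B (e n)"
  shows "A = B"
proof (rule blinfun_eqI)
  fix x
  show "A x = B x"
    using sums_blinfun_coord[of A x, OF assms(1)] sums_blinfun_coord[of B x, OF assms(2)]
    by (simp add: assms(3) sums_unique2)
qed

text \<open>A d/2 argument: a partial sum of x involves finitely many basis vectors, and the uniform
  norm bound controls the remainder.\<close>

lemma tendsto_zero_on_basis:
  fixes A :: "'r \<Rightarrow> 'x \<Rightarrow>\<^sub>L 'x"
  assumes bound: "eventually (\<lambda>r. norm (A r) \<le> M) F"
    and lin: "\<And>r c x. A r (smul c x) = smul c (A r x)"
    and basis: "\<And>k. ((\<lambda>r. A r (e k)) \<longlongrightarrow> 0) F"
  shows "((\<lambda>r. A r x) \<longlongrightarrow> 0) F"
proof (rule tendstoI)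
  fix d :: real
  assume "d > 0"
  \<comment> \<open>The maximum with 1 makes the bound positive, so that it can be divided
    by.\<close>
  define C where "C = max M 1"
  have "C > 0" by (simp add: C_def)
  then obtain n where n: "norm (partial_sum n x - x) < d / (2 * C)"
    using LIMSEQ_D[OF partial_sum_tendsto[of x], of "d / (2 * C)"] \<open>d > 0\<close> by auto
  have "((\<lambda>r. \<Sum>k<n. smul (coord x k) (A r (e k))) \<longlongrightarrow> (\<Sum>k<n. smul (coord x k) 0)) F"
    by (intro tendsto_sum bounded_linear.tendsto[OF bounded_linear_smul_right] basis)
  then have "((\<lambda>r. A r (partial_sum n x)) \<longlongrightarrow> 0) F"
    by (simp add: partial_sum_def blinfun.sum_right lin)
  then have "eventually (\<lambda>r. norm (A r (partial_sum n x)) < d / 2) F"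
    using \<open>d > 0\<close> by (intro order_tendstoD(2)[OF tendsto_norm_zero]) auto
  with bound show "eventually (\<lambda>r. dist (A r x) 0 < d) F"
  proof eventually_elim
    case (elim r)
    have "A r x = A r (partial_sum n x) - A r (partial_sum n x - x)"
      by (simp add: blinfun.diff_right)
    then have "norm (A r x) \<le> norm (A r (partial_sum n x)) + norm (A r (partial_sum n x - x))"
      using norm_triangle_ineq4 by metis
    also have "norm (A r (partial_sum n x - x)) \<le> C * norm (partial_sum n x - x)"
      using elim(1) by (intro order_trans[OF norm_blinfun] mult_right_mono) (auto simp: C_def)
    also have "\<dots> < d / 2"
      using n \<open>C > 0\<close> by (simp add: field_simps)
    finally show ?case using elim(2) by simp
  qed
qed

text \<open>
  \<open>diagonal_semigroup t\<close> multiplies the \<open>k\<close>-th coordinate by \<open>exp (- t / (k + 1))\<close>. Summation by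
  parts writes it as an operator-norm convergent combination of the partial sum projections.
\<close>

definition decay :: "nat \<Rightarrow> real \<Rightarrow> real" where
  "decay k t = exp (- t / real (Suc k))"

definition diagonal_semigroup :: "real \<Rightarrow> 'x \<Rightarrow>\<^sub>L 'x" where
  "diagonal_semigroup t =
     id_blinfun - (\<Sum>n. (decay (Suc n) t - decay n t) *\<^sub>R Blinfun (partial_sum (Suc n)))"

lemma decay_tendsto: "(\<lambda>n. decay n t) \<longlonglongrightarrow> 1"
proof -
  have "(\<lambda>n. - t / real (Suc n)) \<longlonglongrightarrow> 0"
    by (rule LIMSEQ_Suc) (rule lim_const_over_n)
  from tendsto_exp[OF this] show ?thesis by (simp add: decay_def)
qed

lemma decay_Suc_ge: "t \<ge> 0 \<Longrightarrow> decay n t \<le> decay (Suc n) t"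
  by (simp add: decay_def frac_le)

lemma decay_increment_sums: "(\<lambda>n. decay (Suc n) t - decay n t) sums (1 - decay 0 t)"
  using decay_tendsto by (rule telescope_sums)

lemma norm_Blinfun_partial_sum_le:
  obtains K where "K \<ge> 0" and "\<And>n. norm (Blinfun (partial_sum n)) \<le> K"
proof -
  obtain K where "K \<ge> 0" "\<And>n x. norm (partial_sum n x) \<le> K * norm x"
    using partial_sums_uniformly_bounded by blast
  then show ?thesis
    by (intro that[of K] norm_blinfun_bound)
      (simp_all add: bounded_linear_Blinfun_apply bounded_linear_partial_sum)
qed

lemma diagonal_terms_summable:
  assumes "t \<ge> 0"
  shows "summable (\<lambda>n. norm ((decay (Suc n) t - decay n t) *\<^sub>R Blinfun (partial_sum (Suc n))))"
proof -
  obtain K where K: "K \<ge> 0" "\<And>n. norm (Blinfun (partial_sum n)) \<le> K"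
    using norm_Blinfun_partial_sum_le by blast
  have "summable (\<lambda>n. (decay (Suc n) t - decay n t) * K)"
    by (intro summable_mult2 sums_summable[OF decay_increment_sums])
  then show ?thesis
    by (rule summable_comparison_test')
      (simp add: K decay_Suc_ge[OF assms] mult_left_mono)
qed

text \<open>For t \<ge> 0 the increments of \<open>decay\<close> are nonnegative with total at most
  1, so the series has norm at most the common bound K of the projections, independently of
  t.\<close>

lemma norm_diagonal_semigroup_le:
  obtains M where "\<And>t. t \<ge> 0 \<Longrightarrow> norm (diagonal_semigroup t) \<le> M"
proof -
  obtain K where K: "K \<ge> 0" "\<And>n. norm (Blinfun (partial_sum n)) \<le> K"
    using norm_Blinfun_partial_sum_le by blast
  have "norm (diagonal_semigroup t) \<le> 1 + K" if t: "t \<ge> 0" for t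
  proof -
    let ?f = "\<lambda>n. (decay (Suc n) t - decay n t) *\<^sub>R Blinfun (partial_sum (Suc n))"
    have sums: "(\<lambda>n. (decay (Suc n) t - decay n t) * K) sums ((1 - decay 0 t) * K)"
      by (intro sums_mult2 decay_increment_sums)
    have "norm (\<Sum>n. ?f n) \<le> (\<Sum>n. norm (?f n))"
      by (rule summable_norm[OF diagonal_terms_summable[OF t]])
    also have "\<dots> \<le> (\<Sum>n. (decay (Suc n) t - decay n t) * K)"
      using K decay_Suc_ge[OF t]
      by (intro suminf_le diagonal_terms_summable t sums_summable[OF sums]) (simp add: mult_left_mono)
    also have "\<dots> = (1 - decay 0 t) * K"
      using sums by (rule sums_unique[symmetric])
    also have "\<dots> \<le> 1 * K"
      using K(1) by (intro mult_right_mono) (simp_all add: decay_def)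
    finally show ?thesis
      using norm_triangle_ineq4[of id_blinfun "\<Sum>n. ?f n"]
        norm_blinfun_id_le[where 'a='x] unfolding diagonal_semigroup_def by simp
  qed
  then show ?thesis by (rule that)
qed

lemma diagonal_semigroup_sums:
  assumes "t \<ge> 0"
  shows "(\<lambda>n. (decay (Suc n) t - decay n t) *\<^sub>R partial_sum (Suc n) x) sums
    (x - diagonal_semigroup t x)"
proof -
  have "summable (\<lambda>n. (decay (Suc n) t - decay n t) *\<^sub>R Blinfun (partial_sum (Suc n)))"
    using diagonal_terms_summable[OF assms] by (rule summable_norm_cancel)
  from bounded_linear.sums[OF blinfun.bounded_linear_left summable_sums[OF this], of x]
  show ?thesis
    by (simp add: diagonal_semigroup_def blinfun.diff_left blinfun.scaleR_left
        bounded_linear_Blinfun_apply bounded_linear_partial_sum)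
qed

lemma diagonal_semigroup_smul:
  assumes "t \<ge> 0"
  shows "diagonal_semigroup t (smul c x) = smul c (diagonal_semigroup t x)"
proof -
  have "(\<lambda>n. (decay (Suc n) t - decay n t) *\<^sub>R partial_sum (Suc n) (smul c x)) sums
      smul c (x - diagonal_semigroup t x)"
    using bounded_linear.sums[OF bounded_linear_smul_right diagonal_semigroup_sums[OF assms]]
    by (simp add: smul_scaleR partial_sum_smul)
  from sums_unique2[OF this diagonal_semigroup_sums[OF assms]] show ?thesis
    by (simp add: scale_right_diff_distrib)
qed

text \<open>The projection onto the first n + 1 coordinates kills \<open>e k\<close> for n < k and
  fixes it for n \<ge> k, so the increments from k on telescope to
  \<open>1 - decay k t\<close>.\<close>

lemma diagonal_semigroup_basis:
  assumes "t \<ge> 0"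
  shows "diagonal_semigroup t (e k) = decay k t *\<^sub>R e k"
proof -
  \<comment> \<open>Replacing n by \<open>max k n\<close> freezes the sequence up to index k: the
    increments before k become 0, and telescoping may start at 0.\<close>
  have "(\<lambda>n. decay (max k n) t) \<longlonglongrightarrow> 1"
    using decay_tendsto
    by (rule Lim_transform_eventually) (auto simp: eventually_sequentially max_def intro!: exI[of _ k])
  then have "(\<lambda>n. decay (max k (Suc n)) t - decay (max k n) t) sums (1 - decay (max k 0) t)"
    by (rule telescope_sums)
  from sums_scaleR_left[OF this, of "e k"]
  have "(\<lambda>n. (decay (max k (Suc n)) t - decay (max k n) t) *\<^sub>R e k) sums
      ((1 - decay k t) *\<^sub>R e k)"
    by simp
  moreover have "(\<lambda>n. (decay (max k (Suc n)) t - decay (max k n) t) *\<^sub>R e k) =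
      (\<lambda>n. (decay (Suc n) t - decay n t) *\<^sub>R partial_sum (Suc n) (e k))"
    by (auto simp: partial_sum_basis max_def not_less_eq le_Suc_eq)
  ultimately show ?thesis
    using sums_unique2 diagonal_semigroup_sums[OF assms, of "e k"] by (fastforce simp: algebra_simps)
qed

text \<open>The Weierstrass test applies on each compact interval {0..R}, with a majorant depending
  on R; continuity on the half-line then follows locally.\<close>

lemma diagonal_semigroup_continuous: "continuous_on {0..} diagonal_semigroup"
proof -
  obtain K where K: "K \<ge> 0" "\<And>n. norm (Blinfun (partial_sum n)) \<le> K"
    using norm_Blinfun_partial_sum_le by blast
  have cont: "continuous_on {0..R} diagonal_semigroup" if "R \<ge> 0" for R
  proof -
    let ?f = "\<lambda>n t. (decay (Suc n) t - decay n t) *\<^sub>R Blinfun (partial_sum (Suc n))"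
    \<comment> \<open>By \<open>exp_minus_diff_le\<close>, an increment of \<open>decay\<close> at t
      \<le> R is at most R times the increment of the rates; these bounds telescope to a convergent
      series.\<close>
    let ?g = "\<lambda>n. (R / real (Suc n) - R / real (Suc (Suc n))) * K"
    have "(\<lambda>n. R / real (Suc n)) \<longlonglongrightarrow> 0"
      by (rule LIMSEQ_Suc) (rule lim_const_over_n)
    then have "summable ?g"
      by (intro summable_mult2 sums_summable[OF telescope_sums'])
    moreover have "norm (?f n t) \<le> ?g n" if t: "t \<in> {0..R}" for n t
    proof -
      have "decay (Suc n) t - decay n t \<le> t / real (Suc n) - t / real (Suc (Suc n))"
        using exp_minus_diff_le[of "t / real (Suc (Suc n))" "t / real (Suc n)"] t
        by (simp add: decay_def frac_le)
      also have "\<dots> = t * (1 / real (Suc n) - 1 / real (Suc (Suc n)))"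
        by (simp add: algebra_simps)
      also have "\<dots> \<le> R * (1 / real (Suc n) - 1 / real (Suc (Suc n)))"
        using t by (intro mult_right_mono) (auto simp: frac_le)
      also have "\<dots> = R / real (Suc n) - R / real (Suc (Suc n))"
        by (simp add: algebra_simps)
      finally show ?thesis
        using K decay_Suc_ge[of t n] t by (auto intro!: mult_mono)
    qed
    ultimately have lim: "uniform_limit {0..R} (\<lambda>n t. \<Sum>i<n. ?f i t) (\<lambda>t. \<Sum>i. ?f i t) sequentially"
      by (intro Weierstrass_m_test)
    have "continuous_on {0..R} (\<lambda>t. \<Sum>i<n. ?f i t)" for n
      unfolding decay_def by (intro continuous_intros) auto
    then have "continuous_on {0..R} (\<lambda>t. \<Sum>i. ?f i t)"
      by (intro uniform_limit_theorem[OF _ lim]) auto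
    then show ?thesis
      unfolding diagonal_semigroup_def by (intro continuous_intros)
  qed
  show ?thesis
    unfolding continuous_on_eq_continuous_within
  proof
    fix t :: real
    assume t: "t \<in> {0..}"
    \<comment> \<open>Passing to t + 1 keeps t away from the right end of the compact
      interval.\<close>
    have "at t within {0..} = at t within {0..t + 1}"
      by (rule at_within_nhd[of t "{..<t + 1}"]) auto
    moreover have "continuous (at t within {0..t + 1}) diagonal_semigroup"
      using cont[of "t + 1"] t by (simp add: continuous_on_eq_continuous_within)
    ultimately show "continuous (at t within {0..}) diagonal_semigroup"
      by simp
  qed
qed

lemma diagonal_semigroup_add:
  assumes "t \<ge> 0" and "s \<ge> 0"
  shows "diagonal_semigroup (t + s) = diagonal_semigroup t o\<^sub>L diagonal_semigroup s"
proof (rule blinfun_eq_on_basis)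
  show "diagonal_semigroup (t + s) (e n) = (diagonal_semigroup t o\<^sub>L diagonal_semigroup s) (e n)" for n
    using assms by (simp add: diagonal_semigroup_basis blinfun.scaleR_right decay_def
        add_divide_distrib diff_divide_distrib flip: exp_add)
qed (use assms in \<open>simp_all add: diagonal_semigroup_smul\<close>)

lemma uniformly_continuous_diagonal_semigroup:
  "uniformly_continuous_semigroup smul diagonal_semigroup"
  unfolding uniformly_continuous_semigroup_def strongly_continuous_semigroup_def
proof (intro conjI allI impI)
  show "Vector_Spaces.linear smul smul (diagonal_semigroup t)" if "t \<ge> 0" for t
    using that
    by (simp add: Vector_Spaces.linear_iff vector_space_axioms blinfun.add_right diagonal_semigroup_smul)
  show "diagonal_semigroup 0 = id_blinfun"
    by (rule blinfun_eq_on_basis) (simp_all add: diagonal_semigroup_smul diagonal_semigroup_basis decay_def)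
  show "continuous_on {0..} diagonal_semigroup"
    by (rule diagonal_semigroup_continuous)
  show "continuous_on {0..} (\<lambda>t. diagonal_semigroup t x)" for x
    by (intro continuous_intros diagonal_semigroup_continuous)
qed (rule diagonal_semigroup_add)

lemma bounded_diagonal_semigroup: "bounded_semigroup diagonal_semigroup"
proof -
  obtain M where "\<And>t. t \<ge> 0 \<Longrightarrow> norm (diagonal_semigroup t) \<le> M"
    using norm_diagonal_semigroup_le by blast
  then show ?thesis
    unfolding bounded_semigroup_def by (intro bdd_aboveI2[of _ _ M]) simp
qed

section \<open>Cesaro means of the diagonal semigroup\<close>

lemma cesaro_mean_diagonal_basis:
  assumes "r > 0"
  shows "cesaro_mean diagonal_semigroup r (e k) =
    (real (Suc k) / r * (1 - exp (- r / real (Suc k)))) *\<^sub>R e k"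
proof -
  have "integral {0..r} (\<lambda>s. diagonal_semigroup s (e k)) =
      integral {0..r} (\<lambda>s. exp (- s / real (Suc k)) *\<^sub>R e k)"
    by (rule integral_cong) (simp add: diagonal_semigroup_basis decay_def)
  also have "\<dots> = (real (Suc k) * (1 - exp (- r / real (Suc k)))) *\<^sub>R e k"
    using assms by (intro integral_unique exp_minus_scaleR_has_integral) auto
  finally show ?thesis
    unfolding cesaro_mean_def by simp
qed

text \<open>Averages of operators of norm at most M have norm at most M, and on \<open>e k\<close>
  the means decay like (k + 1) / r; \<open>tendsto_zero_on_basis\<close> combines the two.\<close>

lemma cesaro_mean_diagonal_tendsto: "((\<lambda>r. cesaro_mean diagonal_semigroup r x) \<longlongrightarrow> 0) at_top"
proof -
  let ?C = "\<lambda>r. Blinfun (cesaro_mean diagonal_semigroup r)"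
  have apply_C: "?C r x = cesaro_mean diagonal_semigroup r x" for r x
    by (simp add: bounded_linear_Blinfun_apply bounded_linear_cesaro_mean
        diagonal_semigroup_continuous)
  have strong: "strongly_continuous_semigroup smul diagonal_semigroup"
    using uniformly_continuous_diagonal_semigroup by (simp add: uniformly_continuous_semigroup_def)
  obtain M where M: "\<And>t. t \<ge> 0 \<Longrightarrow> norm (diagonal_semigroup t) \<le> M"
    using norm_diagonal_semigroup_le by blast
  have M0: "M \<ge> 0" using M[of 0] norm_ge_zero order_trans by blast
  have norm_C: "norm (?C r) \<le> M" if "r > 0" for r
  proof (rule norm_blinfun_bound[OF M0])
    fix x
    have "norm (integral {0..r} (\<lambda>s. diagonal_semigroup s x)) \<le> M * norm x * (r - 0)"
    proof (rule integral_bound)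
      show "continuous_on {0..r} (\<lambda>s. diagonal_semigroup s x)"
        by (intro continuous_intros continuous_on_subset[OF diagonal_semigroup_continuous]) auto
      show "norm (diagonal_semigroup s x) \<le> M * norm x" if "s \<in> {0..r}" for s
        using that M[of s] by (intro order_trans[OF norm_blinfun] mult_right_mono) auto
    qed (use that in simp)
    then show "norm (?C r x) \<le> M * norm x"
      using that by (simp add: apply_C cesaro_mean_def field_simps)
  qed
  have "((\<lambda>r. ?C r x) \<longlongrightarrow> 0) at_top"
  proof (rule tendsto_zero_on_basis)
    show "eventually (\<lambda>r. norm (?C r) \<le> M) at_top"
      using eventually_gt_at_top[of 0] by eventually_elim (rule norm_C)
    show "?C r (smul c x) = smul c (?C r x)" for r c x
      by (simp add: apply_C cesaro_mean_smul[OF normed_space_over_axioms strong])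
    show "((\<lambda>r. ?C r (e k)) \<longlongrightarrow> 0) at_top" for k
    proof (rule Lim_null_comparison)
      show "eventually (\<lambda>r. norm (?C r (e k)) \<le> real (Suc k) * norm (e k) / r) at_top"
        using eventually_gt_at_top[of 0]
      proof eventually_elim
        case (elim r)
        have "norm (?C r (e k)) = real (Suc k) / r * (1 - exp (- r / real (Suc k))) * norm (e k)"
          using elim by (simp add: apply_C cesaro_mean_diagonal_basis)
        also have "\<dots> \<le> real (Suc k) / r * 1 * norm (e k)"
          using elim by (intro mult_right_mono mult_left_mono) auto
        finally show ?case by simp
      qed
      show "((\<lambda>r. real (Suc k) * norm (e k) / r) \<longlongrightarrow> 0) at_top"
        by (rule real_tendsto_divide_at_top[OF tendsto_const filterlim_ident])
    qed
  qed
  then show ?thesis by (simp add: apply_C)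
qed

lemma mean_ergodic_diagonal_semigroup: "mean_ergodic diagonal_semigroup"
  using cesaro_mean_diagonal_tendsto unfolding mean_ergodic_def by blast

text \<open>A norm limit would agree with the strong limit 0. But for every r > 0 some nonzero
  \<open>e k\<close> is an eigenvector of the mean with eigenvalue at least exp (- 1).\<close>

lemma not_uniformly_mean_ergodic_diagonal_semigroup:
  assumes "\<And>n. e n \<noteq> 0"
  shows "\<not> uniformly_mean_ergodic diagonal_semigroup"
proof
  let ?C = "\<lambda>r. Blinfun (cesaro_mean diagonal_semigroup r)"
  assume "uniformly_mean_ergodic diagonal_semigroup"
  then obtain P where P: "(?C \<longlongrightarrow> P) at_top"
    unfolding uniformly_mean_ergodic_def by blast
  have "P = 0"
  proof (rule blinfun_eqI)
    fix x
    show "P x = blinfun_apply 0 x"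
      using tendsto_unique[OF _ uniformly_mean_ergodic_tendsto[OF diagonal_semigroup_continuous P]
          cesaro_mean_diagonal_tendsto[of x]] by simp
  qed
  with P have "eventually (\<lambda>r. norm (?C r) < exp (- 1)) at_top"
    by (auto simp: tendsto_iff)
  then have "eventually (\<lambda>r. r > 0 \<and> norm (?C r) < exp (- 1)) at_top"
    using eventually_gt_at_top[of 0] by eventually_elim simp
  then obtain r where r: "r > 0" "norm (?C r) < exp (- 1)"
    using eventually_happens'[OF trivial_limit_at_top_linorder] by blast
  \<comment> \<open>Taking k \<ge> r puts u = r / (k + 1) in (0, 1]. The eigenvalue (1 - exp (- u))
    / u is then at least exp (- u), because exp u - 1 \<ge> u, and so at least exp (- 1).\<close>
  obtain k where k: "r \<le> real k" using real_arch_simple by blast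
  define u where "u = r / real (Suc k)"
  have u: "0 < u" "u \<le> 1"
    using r k by (simp_all add: u_def)
  have exp_u: "u \<le> exp u - 1"
    using exp_ge_add_one_self[of u] by linarith
  have "exp (- 1) * u \<le> exp (- u) * u"
    using u by simp
  also have "\<dots> \<le> exp (- u) * (exp u - 1)"
    using exp_u by (rule mult_left_mono) simp
  also have "\<dots> = 1 - exp (- u)"
    by (simp add: right_diff_distrib flip: exp_add)
  finally have "exp (- 1) \<le> 1 / u * (1 - exp (- u))"
    using u by (simp add: field_simps)
  then have "exp (- 1) * norm (e k) \<le> 1 / u * (1 - exp (- u)) * norm (e k)"
    by (rule mult_right_mono) simp
  also have "\<dots> = norm (?C r (e k))"
    using r u by (simp add: u_def cesaro_mean_diagonal_basis bounded_linear_Blinfun_apply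
        bounded_linear_cesaro_mean diagonal_semigroup_continuous)
  also have "\<dots> \<le> norm (?C r) * norm (e k)"
    by (rule norm_blinfun)
  finally show False
    using r(2) assms[of k] by simp
qed

end

section \<open>Schauder bases as expansion systems, and the equivalence\<close>

lemma schauder_basis_nonzero:
  assumes "normed_space_over smul" and "schauder_basis smul e"
  shows "e n \<noteq> 0"
proof
  interpret normed_space_over smul by fact
  assume "e n = 0"
  \<comment> \<open>If \<open>e n\<close> vanished, the indicator of n would be a second expansion
    of 0 besides the zero sequence.\<close>
  then have "(\<lambda>k. smul (if k = n then 1 else 0) (e k)) = (\<lambda>k. 0)"
    by auto
  then have sums: "(\<lambda>k. smul (if k = n then 1 else 0) (e k)) sums 0" "(\<lambda>k. smul 0 (e k)) sums 0"
    by auto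
  have "\<exists>!a. (\<lambda>k. smul (a k) (e k)) sums 0"
    using assms(2) unfolding schauder_basis_def by (rule spec)
  then obtain a where a: "\<And>b. (\<lambda>k. smul (b k) (e k)) sums 0 \<Longrightarrow> b = a"
    by (elim ex1E) blast
  have "(if n = n then 1 else 0) = (0 :: 'a)"
    using fun_cong[OF trans[OF a[OF sums(1)] a[OF sums(2), symmetric]], of n] .
  then show False by simp
qed

text \<open>No vector of a Schauder basis vanishes, so the side condition at zero vectors holds
  automatically and the two uniqueness statements coincide.\<close>

lemma schauder_basis_expansion_system:
  fixes smul :: "'k::{real_normed_field,banach} \<Rightarrow> 'x::banach \<Rightarrow> 'x"
  assumes "normed_space_over smul" and "schauder_basis smul e"
  shows "expansion_system smul e"
  using assms schauder_basis_nonzero[OF assms]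
  by (simp add: expansion_system_def expansion_system_axioms_def schauder_basis_def)

theorem theorem2p6:
  fixes smul :: "'k::{real_normed_field,banach} \<Rightarrow> 'x::banach \<Rightarrow> 'x"
  assumes "normed_space_over smul"
    and "has_basis smul"
  shows "finite_dimensional smul \<longleftrightarrow>
    (\<forall>T :: real \<Rightarrow> 'x \<Rightarrow>\<^sub>L 'x.
       uniformly_continuous_semigroup smul T \<and> bounded_semigroup T \<and> mean_ergodic T
       \<longrightarrow> uniformly_mean_ergodic T)"
proof
  assume "finite_dimensional smul"
  then obtain B where "finite_dimensional_vector_space smul B"
    unfolding finite_dimensional_def by blast
  with assms(1) obtain e N where "expansion_system smul e" "\<And>n. n \<ge> N \<Longrightarrow> e n = 0"
    by (rule finite_basis_expansion_system) blast
  then show "\<forall>T. uniformly_continuous_semigroup smul T \<and> bounded_semigroup T \<and> mean_ergodic T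
      \<longrightarrow> uniformly_mean_ergodic T"
    using expansion_system.mean_ergodic_imp_uniformly by blast
next
  assume *: "\<forall>T. uniformly_continuous_semigroup smul T \<and> bounded_semigroup T \<and> mean_ergodic T
      \<longrightarrow> uniformly_mean_ergodic T"
  show "finite_dimensional smul"
  proof (rule ccontr)
    assume "\<not> finite_dimensional smul"
    then obtain e where e: "schauder_basis smul e"
      using assms(2) unfolding has_basis_def finite_dimensional_def by blast
    interpret expansion_system smul e
      using assms(1) e by (rule schauder_basis_expansion_system)
    have "\<not> uniformly_mean_ergodic diagonal_semigroup"
      using schauder_basis_nonzero[OF assms(1) e]
      by (rule not_uniformly_mean_ergodic_diagonal_semigroup)
    then show False
      using * uniformly_continuous_diagonal_semigroup bounded_diagonal_semigroup
        mean_ergodic_diagonal_semigroup by blast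
  qed
qed

end
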